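(* Let $f\colon S^1\to\mathbb{R}$ be a function and let $\lambda,\eta$ be signed Borel measures on $S^1$ such that \[ f(x)=\int_{S^1}d_{S^1}(x,y)\,\lambda(\mathrm{d}y)=\int_{S^1}d_{S^1}(x,y)\,\eta(\mathrm{d}y)\qquad\text{for all }x\in S^1 . \] Then $\lambda^a=\eta^a$, where $\lambda^a$ and $\eta^a$ denote the anti-symmetric parts of $\lambda$ and $\eta$ with respect to the antipodal map.
   Context: $S^1\subset\mathbb{R}^2$ is the unit circle with the spherical distance $d_{S^1}(x,y)=\arccos(\langle x,y\rangle)$ (the length of the shorter arc between $x$ and $y$). A signed (Borel) measure on $S^1$ is a countably additive function $\lambda\colon\mathcal{B}(S^1)\to\mathbb{R}$ (finite real values) with $\lambda(\emptyset)=0$. $T\colon S^1\to S^1$ is the antipodal map $T(x)=-x$, and $T_\#\lambda$ denotes the push-forward of $\lambda$ under $T$. Every signed measure $\lambda$ decomposes uniquely as $\lambda=\lambda^a+\lambda^s$ with $T_\#\lambda^a=-\lambda^a$ (anti-symmetric part) and $T_\#\lambda^s=\lambda^s$ (symmetric part); explicitly $\lambda^a=\tfrac12(\lambda-T_\#\lambda)$ and $\lambda^s=\tfrac12(\lambda+T_\#\lambda)$. *)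

theory Defs
  imports "HOL-Analysis.Analysis"
begin

section \<open>Real-valued signed measures\<close>

text \<open>
  A signed measure on the measurable space underlying \<open>M\<close> is a real-valued set function; only its
  values on \<^term>\<open>sets M\<close> are meaningful, and the measure carried by \<open>M\<close> itself is ignored.
\<close>

definition signed_measure :: "'a measure \<Rightarrow> ('a set \<Rightarrow> real) \<Rightarrow> bool" where
  "signed_measure M \<mu> \<longleftrightarrow> \<mu> {} = 0 \<and>
     (\<forall>A. range A \<subseteq> sets M \<longrightarrow> disjoint_family A \<longrightarrow> (\<lambda>i::nat. \<mu> (A i)) sums \<mu> (\<Union>i. A i))"

text \<open>
  The positive part of the Jordan decomposition, by the formula
  \<open>\<mu>\<^sup>+ A = sup {\<mu> B | B \<subseteq> A}\<close>. Since \<open>\<mu> {} = 0\<close>, the truncation of negative values by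
  \<^term>\<open>ennreal\<close> does not change the supremum. The negative part is the positive part of \<open>- \<mu>\<close>.
\<close>

definition pos_part_fun :: "'a measure \<Rightarrow> ('a set \<Rightarrow> real) \<Rightarrow> 'a set \<Rightarrow> ennreal" where
  "pos_part_fun M \<mu> A = (SUP B\<in>{B \<in> sets M. B \<subseteq> A}. ennreal (\<mu> B))"

definition pos_part :: "'a measure \<Rightarrow> ('a set \<Rightarrow> real) \<Rightarrow> 'a measure" where
  "pos_part M \<mu> = measure_of (space M) (sets M) (pos_part_fun M \<mu>)"

definition neg_part :: "'a measure \<Rightarrow> ('a set \<Rightarrow> real) \<Rightarrow> 'a measure" where
  "neg_part M \<mu> = pos_part M (\<lambda>A. - \<mu> A)"

definition signed_integral ::
    "'a measure \<Rightarrow> ('a set \<Rightarrow> real) \<Rightarrow> ('a \<Rightarrow> real) \<Rightarrow> real" where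
  "signed_integral M \<mu> g = integral\<^sup>L (pos_part M \<mu>) g - integral\<^sup>L (neg_part M \<mu>) g"

definition signed_distr ::
    "'a measure \<Rightarrow> ('a \<Rightarrow> 'b) \<Rightarrow> ('a set \<Rightarrow> real) \<Rightarrow> 'b set \<Rightarrow> real" where
  "signed_distr M T \<mu> A = \<mu> (T -` A \<inter> space M)"

lemma signed_measure_add:
  assumes "signed_measure M \<mu>" "A \<in> sets M" "B \<in> sets M" "A \<inter> B = {}"
  shows "\<mu> (A \<union> B) = \<mu> A + \<mu> B"
proof -
  have "(\<lambda>i. \<mu> (binaryset A B i)) sums \<mu> (\<Union>i. binaryset A B i)"
  proof (rule conjunct2[OF assms(1)[unfolded signed_measure_def], rule_format])
    show "range (binaryset A B) \<subseteq> sets M"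
      using assms(2,3) by (simp add: range_binaryset_eq)
    show "disjoint_family (binaryset A B)"
      using assms(4) by (auto simp: disjoint_family_on_def binaryset_def)
  qed
  moreover have "(\<lambda>i. \<mu> (binaryset A B i)) sums (\<Sum>i<2. \<mu> (binaryset A B i))"
    using assms(1) by (intro sums_finite) (auto simp: binaryset_def signed_measure_def)
  ultimately have "\<mu> (\<Union>i. binaryset A B i) = (\<Sum>i<2. \<mu> (binaryset A B i))"
    by (rule sums_unique2)
  then show ?thesis
    by (simp add: UN_binaryset_eq) (simp add: binaryset_def eval_nat_numeral)
qed

lemma pos_part_fun_add_le:
  assumes \<mu>: "signed_measure M \<mu>" and "A \<inter> A' = {}"
  shows "pos_part_fun M \<mu> A + pos_part_fun M \<mu> A' \<le> pos_part_fun M \<mu> (A \<union> A')"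
proof -
  have *: "ennreal (\<mu> B) + ennreal (\<mu> B') \<le> pos_part_fun M \<mu> (A \<union> A')"
    if B: "B \<in> sets M" "B \<subseteq> A" "B' \<in> sets M" "B' \<subseteq> A'" for B B'
  proof -
    have up: "ennreal (\<mu> C) \<le> pos_part_fun M \<mu> (A \<union> A')" if "C \<in> sets M" "C \<subseteq> A \<union> A'" for C
      unfolding pos_part_fun_def using that by (intro SUP_upper) auto
    have "\<mu> (B \<union> B') = \<mu> B + \<mu> B'"
      using assms B by (intro signed_measure_add[OF \<mu>]) auto
    moreover have "ennreal (\<mu> (B \<union> B')) \<le> pos_part_fun M \<mu> (A \<union> A')"
      using B by (intro up) auto
    moreover have "ennreal (\<mu> B) \<le> pos_part_fun M \<mu> (A \<union> A')"
      "ennreal (\<mu> B') \<le> pos_part_fun M \<mu> (A \<union> A')"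
      using B by (auto intro!: up)
    ultimately show ?thesis
      by (cases "\<mu> B \<le> 0"; cases "\<mu> B' \<le> 0") (auto simp: ennreal_neg)
  qed
  have ne: "{B \<in> sets M. B \<subseteq> X} \<noteq> {}" for X by blast
  show ?thesis
    unfolding pos_part_fun_def[of M \<mu> A] pos_part_fun_def[of M \<mu> A']
    by (auto intro!: SUP_least *
        simp: ennreal_SUP_add_left[OF ne, symmetric] ennreal_SUP_add_right[OF ne])
qed

lemma emeasure_pos_part:
  assumes \<mu>: "signed_measure M \<mu>" and "A \<in> sets M"
  shows "emeasure (pos_part M \<mu>) A = pos_part_fun M \<mu> A"
proof (rule emeasure_measure_of[OF pos_part_def])
  have mono: "pos_part_fun M \<mu> X \<le> pos_part_fun M \<mu> Y" if "X \<subseteq> Y" for X Y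
    unfolding pos_part_fun_def using that by (intro SUP_subset_mono) auto
  have empty: "pos_part_fun M \<mu> {} = 0"
    using \<mu> unfolding pos_part_fun_def signed_measure_def
    by (simp add: subset_empty cong: conj_cong)
  show "positive (sets (pos_part M \<mu>)) (pos_part_fun M \<mu>)"
    by (simp add: positive_def empty)
  have sets_eq: "sets (pos_part M \<mu>) = sets M"
    by (simp add: pos_part_def)
  show "countably_additive (sets (pos_part M \<mu>)) (pos_part_fun M \<mu>)"
    unfolding sets_eq
  proof (rule countably_additiveI)
    fix A :: "nat \<Rightarrow> 'a set"
    assume A: "range A \<subseteq> sets M" "disjoint_family A"
    have fin: "(\<Sum>i<n. pos_part_fun M \<mu> (A i)) \<le> pos_part_fun M \<mu> (\<Union>i<n. A i)" for n
    proof (induction n)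
      case (Suc n)
      have disj: "(\<Union>i<n. A i) \<inter> A n = {}"
      proof -
        have "A i \<inter> A n = {}" if "i < n" for i
          using that by (intro disjoint_family_onD[OF A(2)]) auto
        then show ?thesis by blast
      qed
      have "(\<Sum>i<Suc n. pos_part_fun M \<mu> (A i))
          \<le> pos_part_fun M \<mu> (\<Union>i<n. A i) + pos_part_fun M \<mu> (A n)"
        using Suc by (simp add: add_right_mono)
      also have "\<dots> \<le> pos_part_fun M \<mu> ((\<Union>i<n. A i) \<union> A n)"
        by (rule pos_part_fun_add_le[OF \<mu> disj])
      also have "(\<Union>i<n. A i) \<union> A n = (\<Union>i<Suc n. A i)"
        by (simp add: lessThan_Suc Un_commute)
      finally show ?case .
    qed simp
    show "(\<Sum>i. pos_part_fun M \<mu> (A i)) = pos_part_fun M \<mu> (\<Union>i. A i)"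
    proof (rule antisym)
      show "(\<Sum>i. pos_part_fun M \<mu> (A i)) \<le> pos_part_fun M \<mu> (\<Union>i. A i)"
      proof (rule suminf_le_const)
        show "(\<Sum>i<n. pos_part_fun M \<mu> (A i)) \<le> pos_part_fun M \<mu> (\<Union>i. A i)" for n
          by (rule order_trans[OF fin mono]) auto
      qed simp
      show "pos_part_fun M \<mu> (\<Union>i. A i) \<le> (\<Sum>i. pos_part_fun M \<mu> (A i))"
        unfolding pos_part_fun_def[of M \<mu> "\<Union>i. A i"]
      proof (rule SUP_least)
        fix B assume "B \<in> {B \<in> sets M. B \<subseteq> (\<Union>i. A i)}"
        then have B: "B \<in> sets M" "B = (\<Union>i. B \<inter> A i)" by auto
        have "(\<lambda>i. \<mu> (B \<inter> A i)) sums \<mu> (\<Union>i. B \<inter> A i)"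
        proof (rule conjunct2[OF \<mu>[unfolded signed_measure_def], rule_format])
          show "range (\<lambda>i. B \<inter> A i) \<subseteq> sets M"
            using A(1) B(1) by auto
          show "disjoint_family (\<lambda>i. B \<inter> A i)"
            using A(2) by (rule disjoint_family_on_bisimulation) auto
        qed
        then have lim: "(\<lambda>n. ennreal (\<Sum>i<n. \<mu> (B \<inter> A i))) \<longlonglongrightarrow> ennreal (\<mu> B)"
          unfolding sums_def B(2)[symmetric] by (rule tendsto_ennrealI)
        have "ennreal (\<Sum>i<n. \<mu> (B \<inter> A i)) \<le> (\<Sum>i. pos_part_fun M \<mu> (A i))" for n
        proof -
          have "ennreal (\<Sum>i<n. \<mu> (B \<inter> A i)) \<le> ennreal (\<Sum>i<n. max 0 (\<mu> (B \<inter> A i)))"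
            by (intro ennreal_leI sum_mono) auto
          also have "\<dots> = (\<Sum>i<n. ennreal (max 0 (\<mu> (B \<inter> A i))))"
            by (rule sum_ennreal[symmetric]) auto
          also have "\<dots> \<le> (\<Sum>i<n. pos_part_fun M \<mu> (A i))"
          proof (rule sum_mono)
            fix i
            have "ennreal (\<mu> (B \<inter> A i)) \<le> pos_part_fun M \<mu> (A i)"
              unfolding pos_part_fun_def using A B(1) by (intro SUP_upper) auto
            then show "ennreal (max 0 (\<mu> (B \<inter> A i))) \<le> pos_part_fun M \<mu> (A i)"
              by (simp add: max_def)
          qed
          also have "\<dots> \<le> (\<Sum>i. pos_part_fun M \<mu> (A i))"
            by (rule sum_le_suminf) auto
          finally show ?thesis .
        qed
        then show "ennreal (\<mu> B) \<le> (\<Sum>i. pos_part_fun M \<mu> (A i))"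
          by (intro LIMSEQ_le_const2[OF lim]) auto
      qed
    qed
  qed
  show "A \<in> sets (pos_part M \<mu>)"
    using assms(2) by (simp add: sets_eq)
qed (rule sets.space_closed)


section \<open>The circle\<close>

definition circle :: "(real^2) set" where
  "circle = sphere 0 1"

definition circle_borel :: "(real^2) measure" where
  "circle_borel = restrict_space borel circle"

definition circle_dist :: "real^2 \<Rightarrow> real^2 \<Rightarrow> real" where
  "circle_dist x y = arccos (x \<bullet> y)"

definition antipodal :: "real^2 \<Rightarrow> real^2" where
  "antipodal x = - x"

definition antisym_part :: "((real^2) set \<Rightarrow> real) \<Rightarrow> (real^2) set \<Rightarrow> real" where
  "antisym_part \<mu> A = (\<mu> A - signed_distr circle_borel antipodal \<mu> A) / 2"

definition sym_part :: "((real^2) set \<Rightarrow> real) \<Rightarrow> (real^2) set \<Rightarrow> real" where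
  "sym_part \<mu> A = (\<mu> A + signed_distr circle_borel antipodal \<mu> A) / 2"

lemma space_circle_borel: "space circle_borel = circle"
  by (simp add: circle_borel_def space_restrict_space)

lemma measurable_antipodal: "antipodal \<in> circle_borel \<rightarrow>\<^sub>M circle_borel"
  unfolding circle_borel_def antipodal_def
  by (intro measurable_restrict_space3) (auto simp: circle_def)

lemma signed_distr_antipodal_twice:
  assumes "A \<in> sets circle_borel"
  shows "signed_distr circle_borel antipodal (signed_distr circle_borel antipodal \<mu>) A = \<mu> A"
proof -
  have "antipodal -` (antipodal -` A \<inter> circle) \<inter> circle = A"
    using sets.sets_into_space[OF assms] by (auto simp: antipodal_def circle_def space_circle_borel)
  then show ?thesis
    by (simp add: signed_distr_def space_circle_borel)
qed

lemma antisym_part_antisym: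
  assumes "A \<in> sets circle_borel"
  shows "signed_distr circle_borel antipodal (antisym_part \<mu>) A = - antisym_part \<mu> A"
  using signed_distr_antipodal_twice[OF assms, of \<mu>]
  by (simp add: antisym_part_def signed_distr_def field_simps)

lemma sym_part_sym:
  assumes "A \<in> sets circle_borel"
  shows "signed_distr circle_borel antipodal (sym_part \<mu>) A = sym_part \<mu> A"
  using signed_distr_antipodal_twice[OF assms, of \<mu>]
  by (simp add: sym_part_def signed_distr_def field_simps)

lemma antisym_part_unique:
  assumes decomp: "\<And>A. A \<in> sets circle_borel \<Longrightarrow> \<mu> A = \<alpha> A + \<sigma> A"
    and "\<And>A. A \<in> sets circle_borel \<Longrightarrow> signed_distr circle_borel antipodal \<alpha> A = - \<alpha> A"
    and "\<And>A. A \<in> sets circle_borel \<Longrightarrow> signed_distr circle_borel antipodal \<sigma> A = \<sigma> A"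
    and A: "A \<in> sets circle_borel"
  shows "\<alpha> A = antisym_part \<mu> A" "\<sigma> A = sym_part \<mu> A"
  using assms(2,3)[OF A] decomp[OF A] decomp[OF measurable_sets[OF measurable_antipodal A]]
  by (simp_all add: antisym_part_def sym_part_def signed_distr_def)

end

theory Submission
  imports Defs
begin

text \<open>
  Write a point of the circle as \<open>e(t) = (cos t, sin t)\<close>. Moving \<open>x = e(t)\<close> counterclockwise, the
  distance from \<open>x\<close> to \<open>y\<close> grows at unit speed when \<open>y\<close> lies on the half circle behind \<open>x\<close>, and
  shrinks at unit speed when \<open>y\<close> lies on the half circle ahead of \<open>x\<close>. So the function
  \<open>t \<mapsto> \<integral> d(e(t), y) \<mu>(dy)\<close> has at \<open>t\<close> the right derivative
  \<open>\<mu>(half circle behind) - \<mu>(half circle ahead)\<close>, by dominated convergence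
  (\<open>circle_dist_integral_right_derivative\<close>). If \<open>\<lambda>\<close> and \<open>\<eta>\<close> give the same function, then
  \<open>\<mu> = \<lambda> - \<eta>\<close> assigns the same value to a half-open half circle and to its antipode.

  Comparing this identity for the end points of a short arc, everything cancels except the arc and
  its antipode, so \<open>\<mu>\<close> assigns the same value to these two as well
  (\<open>arc_antipodal_eq_if_half_circles_eq\<close>). Hence \<open>\<mu> - T\<^sub># \<mu>\<close> vanishes on arcs up to length \<open>\<pi>\<close>. Cutting the
  circle open at one point turns arcs that start there into rays of the real line, and these
  determine a signed measure (\<open>signed_measure_circle_eq_0\<close>). Therefore \<open>\<mu> - T\<^sub># \<mu> = 0\<close>, which says
  that \<open>\<lambda>\<close> and \<open>\<eta>\<close> have the same anti-symmetric part.

  Dominated convergence for a signed measure is reduced to its positive and negative parts, and for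
  this they must be finite (\<open>finite_measure_pos_part\<close>).
\<close>

section \<open>Signed measures\<close>

lemma signed_measure_empty: "signed_measure M \<mu> \<Longrightarrow> \<mu> {} = 0"
  by (simp add: signed_measure_def)

lemma signed_measure_sums:
  assumes "signed_measure M \<mu>" "range A \<subseteq> sets M" "disjoint_family A"
  shows "(\<lambda>i::nat. \<mu> (A i)) sums \<mu> (\<Union>i. A i)"
  using assms by (simp add: signed_measure_def)

lemma signed_measure_Diff:
  assumes "signed_measure M \<mu>" "A \<in> sets M" "B \<in> sets M" "B \<subseteq> A"
  shows "\<mu> (A - B) = \<mu> A - \<mu> B"
proof -
  have "\<mu> ((A - B) \<union> B) = \<mu> (A - B) + \<mu> B"
    using assms by (intro signed_measure_add[OF assms(1)]) auto
  moreover have "(A - B) \<union> B = A" using assms(4) by auto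
  ultimately show ?thesis by simp
qed

lemma signed_measure_uminus:
  "signed_measure M \<mu> \<Longrightarrow> signed_measure M (\<lambda>A. - \<mu> A)"
  unfolding signed_measure_def by (auto intro!: sums_minus)

lemma signed_measure_diff:
  "signed_measure M \<mu> \<Longrightarrow> signed_measure M \<nu> \<Longrightarrow> signed_measure M (\<lambda>A. \<mu> A - \<nu> A)"
  unfolding signed_measure_def by (auto intro!: sums_diff)

lemma signed_measure_distr:
  assumes \<mu>: "signed_measure M \<mu>" and T: "T \<in> M \<rightarrow>\<^sub>M N"
  shows "signed_measure N (signed_distr M T \<mu>)"
  unfolding signed_measure_def signed_distr_def
proof (intro conjI allI impI)
  show "\<mu> (T -` {} \<inter> space M) = 0" using \<mu> by (simp add: signed_measure_empty)
next
  fix A :: "nat \<Rightarrow> _" assume A: "range A \<subseteq> sets N" "disjoint_family A"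
  have "(\<lambda>i. \<mu> (T -` A i \<inter> space M)) sums \<mu> (\<Union>i. T -` A i \<inter> space M)"
  proof (rule signed_measure_sums[OF \<mu>])
    show "range (\<lambda>i. T -` A i \<inter> space M) \<subseteq> sets M"
      using A(1) T by (auto intro: measurable_sets)
    show "disjoint_family (\<lambda>i. T -` A i \<inter> space M)"
      using A(2) unfolding disjoint_family_on_def by blast
  qed
  then show "(\<lambda>i. \<mu> (T -` A i \<inter> space M)) sums \<mu> (T -` (\<Union>i. A i) \<inter> space M)"
    by (simp add: vimage_UN)
qed

section \<open>Jordan decomposition\<close>

lemma sets_pos_part [simp]: "sets (pos_part M \<mu>) = sets M"
  by (simp add: pos_part_def)

lemma space_pos_part [simp]: "space (pos_part M \<mu>) = space M"
  by (simp add: pos_part_def)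

text \<open>
  Inside \<open>E\<close> there is a set \<open>B\<close> with \<open>\<mu> B > \<bar>\<mu> E\<bar> + 1\<close>, and then both \<open>B\<close> and \<open>E - B\<close> have values of
  modulus at least 1. One of the two again has infinite positive part; keep it and discard the other.
\<close>

lemma pos_part_infinite_shrink:
  assumes \<mu>: "signed_measure M \<mu>" and E: "E \<in> sets M" "emeasure (pos_part M \<mu>) E = \<infinity>"
  shows "\<exists>E'. E' \<in> sets M \<and> emeasure (pos_part M \<mu>) E' = \<infinity> \<and> E' \<subseteq> E \<and> 1 \<le> \<bar>\<mu> (E - E')\<bar>"
proof -
  have "ennreal (\<bar>\<mu> E\<bar> + 1) < pos_part_fun M \<mu> E"
    using E by (simp add: emeasure_pos_part[OF \<mu>])
  then obtain B where B: "B \<in> sets M" "B \<subseteq> E" "ennreal (\<bar>\<mu> E\<bar> + 1) < ennreal (\<mu> B)"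
    unfolding pos_part_fun_def less_SUP_iff by auto
  from B(3) have big: "\<bar>\<mu> E\<bar> + 1 < \<mu> B"
    by (subst (asm) ennreal_less_iff) auto
  have diff: "\<mu> (E - B) = \<mu> E - \<mu> B"
    by (rule signed_measure_Diff[OF \<mu> E(1) B(1,2)])
  have "emeasure (pos_part M \<mu>) B + emeasure (pos_part M \<mu>) (E - B) = emeasure (pos_part M \<mu>) E"
    using B E by (subst plus_emeasure) (auto simp: Un_absorb1)
  then consider "emeasure (pos_part M \<mu>) B = \<infinity>" | "emeasure (pos_part M \<mu>) (E - B) = \<infinity>"
    using E(2) by (auto simp: ennreal_add_eq_top)
  then show ?thesis
  proof cases
    case 1
    then show ?thesis using B big diff by (intro exI[of _ B]) auto
  next
    case 2
    moreover have "E - (E - B) = B" using B by auto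
    ultimately show ?thesis using B E big by (intro exI[of _ "E - B"]) auto
  qed
qed

text \<open>
  A signed measure with finite values has finite variation: otherwise, shrinking the space again and
  again, one discards infinitely many disjoint pieces with values of modulus at least 1, and the
  series of these values cannot converge.
\<close>

lemma finite_measure_pos_part:
  assumes \<mu>: "signed_measure M \<mu>"
  shows "finite_measure (pos_part M \<mu>)"
proof (rule finite_measureI, rule notI)
  let ?P = "\<lambda>E. E \<in> sets M \<and> emeasure (pos_part M \<mu>) E = \<infinity>"
  assume inf: "emeasure (pos_part M \<mu>) (space (pos_part M \<mu>)) = \<infinity>"
  have "\<exists>E. \<forall>n. ?P (E n) \<and> (E (Suc n) \<subseteq> E n \<and> 1 \<le> \<bar>\<mu> (E n - E (Suc n))\<bar>)"
  proof (rule dependent_nat_choice)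
    show "\<exists>E. ?P E" using inf by (intro exI[of _ "space M"]) auto
  next
    fix E assume "?P E"
    then show "\<exists>E'. ?P E' \<and> (E' \<subseteq> E \<and> 1 \<le> \<bar>\<mu> (E - E')\<bar>)"
      using pos_part_infinite_shrink[OF \<mu>, of E] by blast
  qed
  then obtain E where E: "\<And>n. E n \<in> sets M" "\<And>n. E (Suc n) \<subseteq> E n"
      "\<And>n::nat. 1 \<le> \<bar>\<mu> (E n - E (Suc n))\<bar>" by blast
  have anti: "E n \<subseteq> E m" if "m \<le> n" for m n
    using E(2) that by (rule lift_Suc_antimono_le)
  have "(\<lambda>n. \<mu> (E n - E (Suc n))) sums \<mu> (\<Union>n. E n - E (Suc n))"
  proof (rule signed_measure_sums[OF \<mu>])
    show "range (\<lambda>n. E n - E (Suc n)) \<subseteq> sets M" using E(1) by auto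
    have "(E m - E (Suc m)) \<inter> (E n - E (Suc n)) = {}" if "m < n" for m n
      using anti[of "Suc m" n] that by auto
    then show "disjoint_family (\<lambda>n. E n - E (Suc n))"
      unfolding disjoint_family_on_def by (metis Int_commute linorder_neqE_nat)
  qed
  then have "(\<lambda>n. \<mu> (E n - E (Suc n))) \<longlonglongrightarrow> 0"
    by (intro summable_LIMSEQ_zero sums_summable)
  then have "\<forall>\<^sub>F n in sequentially. \<bar>\<mu> (E n - E (Suc n))\<bar> < 1"
    by (auto simp: tendsto_iff dist_real_def dest: spec[of _ 1])
  then have "\<forall>\<^sub>F n::nat in sequentially. False"
    by (rule eventually_mono) (use E(3) in \<open>auto simp: not_less[symmetric]\<close>)
  then show False by simp
qed

lemma le_measure_pos_part:
  assumes \<mu>: "signed_measure M \<mu>" and "A \<in> sets M" "B \<in> sets M" "B \<subseteq> A"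
  shows "\<mu> B \<le> measure (pos_part M \<mu>) A"
proof -
  interpret finite_measure "pos_part M \<mu>" by (rule finite_measure_pos_part[OF \<mu>])
  have "ennreal (\<mu> B) \<le> ennreal (measure (pos_part M \<mu>) A)"
    unfolding emeasure_eq_measure[symmetric] emeasure_pos_part[OF \<mu> assms(2)] pos_part_fun_def
    using assms by (intro SUP_upper) auto
  then show ?thesis by (simp add: ennreal_le_iff)
qed

lemma measure_pos_part_le:
  assumes \<mu>: "signed_measure M \<mu>" and "A \<in> sets M"
    and le: "\<And>B. B \<in> sets M \<Longrightarrow> B \<subseteq> A \<Longrightarrow> \<mu> B \<le> c"
  shows "measure (pos_part M \<mu>) A \<le> c"
proof -
  interpret finite_measure "pos_part M \<mu>" by (rule finite_measure_pos_part[OF \<mu>])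
  have "0 \<le> c" using le[of "{}"] signed_measure_empty[OF \<mu>] by simp
  moreover have "emeasure (pos_part M \<mu>) A \<le> ennreal c"
    unfolding emeasure_pos_part[OF \<mu> assms(2)] pos_part_fun_def
    using le by (intro SUP_least) (auto intro: ennreal_leI)
  ultimately show ?thesis by (simp add: emeasure_eq_measure)
qed

text \<open>
  For \<open>B \<subseteq> A\<close> one has \<open>\<mu> B = \<mu> A + (- \<mu> (A - B))\<close>; taking the supremum over \<open>B\<close> gives
  \<open>\<mu>\<^sup>+ A \<le> \<mu> A + \<mu>\<^sup>- A\<close>, and exchanging \<open>\<mu>\<close> and \<open>- \<mu>\<close> gives the converse inequality.
\<close>

lemma Jordan_decomposition:
  assumes \<mu>: "signed_measure M \<mu>" and A: "A \<in> sets M"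
  shows "\<mu> A = measure (pos_part M \<mu>) A - measure (neg_part M \<mu>) A"
proof -
  have half: "measure (pos_part M \<nu>) A \<le> \<nu> A + measure (pos_part M (\<lambda>A. - \<nu> A)) A"
    if \<nu>: "signed_measure M \<nu>" for \<nu>
  proof (rule measure_pos_part_le[OF \<nu> A])
    fix B assume B: "B \<in> sets M" "B \<subseteq> A"
    have "- \<nu> (A - B) \<le> measure (pos_part M (\<lambda>A. - \<nu> A)) A"
      using B A by (intro le_measure_pos_part[OF signed_measure_uminus[OF \<nu>]]) auto
    then show "\<nu> B \<le> \<nu> A + measure (pos_part M (\<lambda>A. - \<nu> A)) A"
      using signed_measure_Diff[OF \<nu> A B] by linarith
  qed
  show ?thesis
    using half[OF \<mu>] half[OF signed_measure_uminus[OF \<mu>]] by (simp add: neg_part_def)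
qed

section \<open>Integration against a signed measure\<close>

lemma integrable_pos_part:
  fixes g :: "'a \<Rightarrow> real"
  assumes \<mu>: "signed_measure M \<mu>" and g: "g \<in> borel_measurable M" "\<And>x. x \<in> space M \<Longrightarrow> \<bar>g x\<bar> \<le> C"
  shows "integrable (pos_part M \<mu>) g"
proof -
  interpret finite_measure "pos_part M \<mu>" by (rule finite_measure_pos_part[OF \<mu>])
  have "g \<in> borel_measurable (pos_part M \<mu>)"
    using g(1) by (simp cong: measurable_cong_sets)
  then show ?thesis
    using g(2) by (intro integrable_const_bound[of _ C]) (auto intro!: AE_I2)
qed

lemma signed_integral_cmult_diff:
  assumes \<mu>: "signed_measure M \<mu>"
    and g: "g \<in> borel_measurable M" "\<And>x. x \<in> space M \<Longrightarrow> \<bar>g x\<bar> \<le> C"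
    and h: "h \<in> borel_measurable M" "\<And>x. x \<in> space M \<Longrightarrow> \<bar>h x\<bar> \<le> D"
  shows "signed_integral M \<mu> (\<lambda>x. c * (g x - h x)) =
    c * (signed_integral M \<mu> g - signed_integral M \<mu> h)"
proof -
  note int = integrable_pos_part[OF \<mu> g] integrable_pos_part[OF \<mu> h]
    integrable_pos_part[OF signed_measure_uminus[OF \<mu>] g]
    integrable_pos_part[OF signed_measure_uminus[OF \<mu>] h]
  show ?thesis
    using int by (simp add: signed_integral_def neg_part_def algebra_simps)
qed

lemma signed_integral_indicator:
  assumes \<mu>: "signed_measure M \<mu>" and A: "A \<in> sets M"
  shows "signed_integral M \<mu> (indicator A) = \<mu> A"
proof -
  have "A \<inter> space M = A" using sets.sets_into_space[OF A] by auto
  then show ?thesis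
    unfolding Jordan_decomposition[OF assms] by (simp add: signed_integral_def neg_part_def)
qed

lemma signed_integral_indicator_diff:
  assumes \<mu>: "signed_measure M \<mu>" and "A \<in> sets M" "B \<in> sets M"
  shows "signed_integral M \<mu> (\<lambda>x. indicator A x - indicator B x) = \<mu> A - \<mu> B"
proof -
  have "signed_integral M \<mu> (\<lambda>x. 1 * (indicator A x - indicator B x)) =
      1 * (signed_integral M \<mu> (indicator A) - signed_integral M \<mu> (indicator B))"
    by (rule signed_integral_cmult_diff[OF \<mu>, where C = 1 and D = 1])
      (use assms in \<open>auto simp: indicator_def\<close>)
  then show ?thesis
    unfolding signed_integral_indicator[OF \<mu> assms(2)] signed_integral_indicator[OF \<mu> assms(3)]
    by simp
qed

lemma signed_integral_bounded_convergence:
  assumes \<mu>: "signed_measure M \<mu>"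
    and g: "\<And>n. g n \<in> borel_measurable M" "\<And>n x. x \<in> space M \<Longrightarrow> \<bar>g n x\<bar> \<le> C"
    and lim: "\<And>x. x \<in> space M \<Longrightarrow> (\<lambda>n. g n x) \<longlonglongrightarrow> h x"
  shows "(\<lambda>n::nat. signed_integral M \<mu> (g n)) \<longlonglongrightarrow> signed_integral M \<mu> h"
proof -
  have h: "h \<in> borel_measurable M"
    using lim g(1) by (rule borel_measurable_LIMSEQ_real)
  have "(\<lambda>n. integral\<^sup>L (pos_part M \<nu>) (g n)) \<longlonglongrightarrow> integral\<^sup>L (pos_part M \<nu>) h"
    if \<nu>: "signed_measure M \<nu>" for \<nu>
  proof (rule integral_dominated_convergence[where w = "\<lambda>_. C"])
    interpret finite_measure "pos_part M \<nu>" by (rule finite_measure_pos_part[OF \<nu>])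
    show "integrable (pos_part M \<nu>) (\<lambda>_. C)" by simp
  qed (use g lim h in \<open>auto intro!: AE_I2 cong: measurable_cong_sets\<close>)
  from this[OF \<mu>] this[OF signed_measure_uminus[OF \<mu>]] show ?thesis
    unfolding signed_integral_def neg_part_def by (intro tendsto_diff)
qed

section \<open>Signed measures on the line\<close>

text \<open>
  Dynkin's argument: the rays are closed under intersection and generate the Borel sets. The total
  mass is assumed to vanish because the complement step starts from it.
\<close>

lemma signed_measure_borel_eq_0:
  fixes \<mu> :: "real set \<Rightarrow> real"
  assumes \<mu>: "signed_measure borel \<mu>" and ray: "\<And>b. \<mu> {..b} = 0" and UNIV: "\<mu> UNIV = 0"
    and A: "A \<in> sets borel"
  shows "\<mu> A = 0"
proof -
  have eq: "sigma_sets UNIV (range (\<lambda>b::real. {..b})) = sets borel"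
    by (simp add: borel_eq_atMost)
  have "Int_stable (range (\<lambda>b::real. {..b}))"
    by (auto simp: Int_stable_def image_iff)
  moreover have "range (\<lambda>b::real. {..b}) \<subseteq> Pow UNIV" by simp
  ultimately show ?thesis
    using A[folded eq]
  proof (induction rule: sigma_sets_induct_disjoint)
    case (basic B) then show ?case using ray by auto
  next
    case empty then show ?case using \<mu> by (rule signed_measure_empty)
  next
    case (compl B)
    then show ?case using signed_measure_Diff[OF \<mu>, of UNIV B] UNIV by (simp add: eq)
  next
    case (union B)
    then have "(\<lambda>i. \<mu> (B i)) sums \<mu> (\<Union>i. B i)"
      by (intro signed_measure_sums[OF \<mu>]) (simp_all add: eq)
    with union show ?case by (simp add: sums_iff)
  qed
qed

section \<open>The angle parameter and half-open arcs\<close>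

definition circle_point :: "real \<Rightarrow> real^2" where
  "circle_point t = vector [cos t, sin t]"

lemma circle_point_nth [simp]: "circle_point t $ 1 = cos t" "circle_point t $ 2 = sin t"
  by (simp_all add: circle_point_def)

lemma inner_circle_point: "circle_point s \<bullet> circle_point t = cos (s - t)"
  by (simp add: inner_vec_def sum_2 cos_diff)

lemma circle_point_in_circle [simp]: "circle_point t \<in> circle"
  by (simp add: circle_def norm_eq_sqrt_inner inner_circle_point)

lemma continuous_circle_point: "continuous_on S circle_point"
proof -
  have "circle_point = (\<lambda>t. \<chi> i. if i = 1 then cos t else sin t)"
    by (auto simp: fun_eq_iff vec_eq_iff forall_2)
  moreover have "continuous_on S (\<lambda>t. (\<chi> i. if i = 1 then cos t else sin t) :: real^2)"
  proof (rule continuous_on_vec_lambda)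
    fix i :: 2
    show "continuous_on S (\<lambda>t. if i = 1 then cos t else sin t)"
      by (cases "i = 1") (auto intro!: continuous_intros)
  qed
  ultimately show ?thesis by (simp only:)
qed

lemma circle_point_eq_iff:
  "circle_point s = circle_point t \<longleftrightarrow> (\<exists>n::int. s = t + 2 * pi * n)"
  using sin_cos_eq_iff[of s t] by (auto simp: vec_eq_iff forall_2)

lemma circle_point_add_pi: "circle_point (t + pi) = - circle_point t"
  by (simp add: vec_eq_iff forall_2)

lemma circle_point_inj:
  assumes "circle_point s = circle_point t" "\<bar>s - t\<bar> < 2 * pi"
  shows "s = t"
proof -
  obtain n :: int where n: "s = t + 2 * pi * n" using assms(1) by (auto simp: circle_point_eq_iff)
  with assms(2) have "2 * pi * \<bar>n\<bar> < 2 * pi * 1" by (simp add: abs_mult)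
  then have "\<bar>n\<bar> < 1" by (subst (asm) mult_less_cancel_left_pos) auto
  with n show ?thesis by simp
qed

lemma circle_point_surj:
  assumes "y \<in> circle"
  obtains t where "c < t" "t \<le> c + 2 * pi" "y = circle_point t"
proof -
  have "(y $ 1)\<^sup>2 + (y $ 2)\<^sup>2 = 1"
    using assms by (simp add: circle_def norm_vec_def L2_set_def sum_2)
  then obtain s where s: "y $ 1 = cos s" "y $ 2 = sin s"
    using sincos_total_2pi by metis
  \<comment> \<open>The number of full turns that separate \<open>s\<close> from the window \<open>{c<..c + 2 * pi}\<close>.\<close>
  define n where "n = \<lceil>(s - c) / (2 * pi)\<rceil> - 1"
  define t where "t = s - 2 * pi * n"
  have "n < (s - c) / (2 * pi)" "(s - c) / (2 * pi) \<le> n + 1" unfolding n_def by linarith+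
  then have "c < t" "t \<le> c + 2 * pi" unfolding t_def by (simp_all add: field_simps)
  moreover have "y = circle_point s" using s by (simp add: vec_eq_iff forall_2)
  then have "y = circle_point t"
    by (auto simp: circle_point_eq_iff t_def intro!: exI[of _ n])
  ultimately show thesis by (rule that)
qed

text \<open>
  The parameters are not reduced modulo \<open>2 * pi\<close>. An interval may then run across any chosen cut
  of the circle, and taking antipodes is a translation of the parameters by \<open>pi\<close>.
\<close>

definition circle_arc :: "real \<Rightarrow> real \<Rightarrow> (real^2) set" where
  "circle_arc a b = circle_point ` {a<..b}"

text \<open>
  Within one window of length \<open>2 * pi\<close> the angle is unique, and arcs can be handled like intervals.
\<close>

lemma circle_point_in_arc_iff:
  assumes "c < t" "t \<le> c + 2 * pi" "c \<le> a" "b \<le> c + 2 * pi"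
  shows "circle_point t \<in> circle_arc a b \<longleftrightarrow> a < t \<and> t \<le> b"
proof
  assume "circle_point t \<in> circle_arc a b"
  then obtain s where s: "circle_point t = circle_point s" "a < s" "s \<le> b"
    by (auto simp: circle_arc_def)
  moreover have "t = s" using assms s by (intro circle_point_inj) auto
  ultimately show "a < t \<and> t \<le> b" by simp
qed (auto simp: circle_arc_def)

lemma arc_subset_circle: "circle_arc a b \<subseteq> circle"
  by (auto simp: circle_arc_def)

lemma arc_full: "circle_arc c (c + 2 * pi) = circle"
proof
  show "circle \<subseteq> circle_arc c (c + 2 * pi)"
  proof
    fix y assume "y \<in> circle"
    then obtain t where "c < t" "t \<le> c + 2 * pi" "y = circle_point t"
      by (rule circle_point_surj)
    then show "y \<in> circle_arc c (c + 2 * pi)" by (auto simp: circle_arc_def)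
  qed
qed (rule arc_subset_circle)

lemma arc_Un: "a \<le> b \<Longrightarrow> b \<le> c \<Longrightarrow> circle_arc a c = circle_arc a b \<union> circle_arc b c"
  by (simp add: circle_arc_def ivl_disj_un flip: image_Un)

lemma arc_disjoint: "c \<le> a + 2 * pi \<Longrightarrow> b \<le> c \<Longrightarrow> a \<le> b \<Longrightarrow> circle_arc a b \<inter> circle_arc b c = {}"
  using circle_point_in_arc_iff[of a _ b c] by (auto simp: circle_arc_def[of a b])

lemma sets_circle_borel: "sets circle_borel = {A. A \<subseteq> circle \<and> A \<in> sets borel}"
proof -
  have "circle \<in> sets borel" by (simp add: circle_def)
  then show ?thesis
    by (auto simp: circle_borel_def sets_restrict_space_iff)
qed

text \<open>
  The closed arc is compact, and since \<open>{a..b}\<close> is shorter than a full turn, its initial point is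
  not hit a second time, so that the half-open arc arises by removing just this point.
\<close>

lemma arc_in_sets:
  assumes "b < a + 2 * pi" shows "circle_arc a b \<in> sets circle_borel"
proof -
  have "circle_arc a b = circle_point ` {a..b} - (if a \<le> b then {circle_point a} else {})"
  proof (cases "a \<le> b")
    case True
    have "circle_point a \<notin> circle_arc a b"
    proof
      assume "circle_point a \<in> circle_arc a b"
      then obtain t where t: "circle_point a = circle_point t" "a < t" "t \<le> b"
        by (auto simp: circle_arc_def)
      moreover have "a = t" using t assms by (intro circle_point_inj) auto
      ultimately show False by simp
    qed
    moreover have "circle_point ` {a..b} = insert (circle_point a) (circle_arc a b)"
    proof -
      have "{a..b} = insert a {a<..b}" using True by auto
      then show ?thesis by (simp add: circle_arc_def)
    qed
    ultimately show ?thesis using True by auto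
  qed (simp add: circle_arc_def)
  moreover have "compact (circle_point ` {a..b})"
    by (intro compact_continuous_image continuous_circle_point) simp
  then have "circle_point ` {a..b} \<in> sets borel" by (intro borel_closed compact_imp_closed)
  ultimately have "circle_arc a b \<in> sets borel" by simp
  then show ?thesis using arc_subset_circle by (simp add: sets_circle_borel)
qed

lemma circle_arc_translate: "circle_arc (a - c) (b - c) = (\<lambda>t. circle_point (t - c)) ` {a<..b}"
proof -
  have "{a - c<..b - c} = (\<lambda>t. t - c) ` {a<..b}"
    by (auto simp: image_iff intro!: bexI[of _ "_ + c"])
  then show ?thesis by (simp add: circle_arc_def image_image)
qed

lemma arc_shift: "circle_arc (a - 2 * pi) (b - 2 * pi) = circle_arc a b"
proof -
  have *: "circle_point (t - 2 * pi) = circle_point t" for t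
    by (auto simp: circle_point_eq_iff intro!: exI[of _ "-1"])
  show ?thesis unfolding circle_arc_translate by (simp add: * circle_arc_def)
qed

lemma antipodal_vimage_arc: "antipodal -` circle_arc a b \<inter> circle = circle_arc (a - pi) (b - pi)"
proof -
  have neg: "- circle_point t = circle_point (t - pi)" for t
    using circle_point_add_pi[of "t - pi"] by simp
  have "antipodal -` circle_arc a b \<inter> circle = uminus ` circle_arc a b"
    using arc_subset_circle[of a b] by (force simp: antipodal_def circle_def image_iff)
  also have "\<dots> = circle_arc (a - pi) (b - pi)"
    unfolding circle_arc_translate by (simp add: circle_arc_def image_image neg)
  finally show ?thesis .
qed

lemma signed_measure_arc_add:
  assumes \<mu>: "signed_measure circle_borel \<mu>" and "a \<le> b" "b \<le> c" "c < a + 2 * pi"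
  shows "\<mu> (circle_arc a c) = \<mu> (circle_arc a b) + \<mu> (circle_arc b c)"
  unfolding arc_Un[OF assms(2,3)] using assms
  by (intro signed_measure_add[OF \<mu>] arc_in_sets arc_disjoint) auto

section \<open>Differentiating the distance integral\<close>

text \<open>
  The function \<open>arccos (cos u)\<close> is the triangle wave: \<open>u\<close> on \<open>{0..pi}\<close>, then \<open>2 * pi - u\<close> on
  \<open>{pi..2 * pi}\<close>, and so on periodically. On each half-open piece the difference quotients from the
  right eventually equal the slope of that piece.
\<close>

lemma arccos_cos_diff_quotient:
  assumes u: "0 \<le> u" "u < 2 * pi"
  shows "(\<lambda>n. real (Suc n) * (arccos (cos (u + 1 / real (Suc n))) - arccos (cos u)))
    \<longlonglongrightarrow> (if u < pi then 1 else - 1)"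
proof -
  have D: "arccos (cos v) = (if v \<le> pi then v else 2 * pi - v)" if "0 \<le> v" "v \<le> 2 * pi" for v
    using arccos_cos[of v] arccos_cos[of "2 * pi - v"] that by auto
  \<comment> \<open>The distance from \<open>u\<close> to the next corner of the triangle wave.\<close>
  define r where "r = (if u < pi then pi else 2 * pi) - u"
  have "0 < r" using u by (simp add: r_def)
  moreover have "(\<lambda>n. 1 / real (Suc n)) \<longlonglongrightarrow> 0" 
    using LIMSEQ_inverse_real_of_nat by (simp add: inverse_eq_divide)
  ultimately have "\<forall>\<^sub>F n in sequentially. 1 / real (Suc n) < r"
    by (intro order_tendstoD)
  then have "\<forall>\<^sub>F n in sequentially. real (Suc n) *
      (arccos (cos (u + 1 / real (Suc n))) - arccos (cos u)) = (if u < pi then 1 else - 1)"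
  proof (rule eventually_mono)
    fix n :: nat assume n: "1 / real (Suc n) < r"
    define h where "h = 1 / real (Suc n)"
    have "0 < h" "h < r" using n by (simp_all add: h_def)
    then have "arccos (cos (u + h)) - arccos (cos u) = (if u < pi then 1 else - 1) * h"
      using u D[of u] D[of "u + h"] by (auto simp: r_def split: if_splits)
    then have "arccos (cos (u + 1 / real (Suc n))) - arccos (cos u) =
        (if u < pi then 1 else - 1) * (1 / real (Suc n))"
      by (simp only: h_def)
    then show "real (Suc n) * (arccos (cos (u + 1 / real (Suc n))) - arccos (cos u)) =
        (if u < pi then 1 else - 1)" by simp
  qed
  then show ?thesis by (rule tendsto_eventually)
qed

lemma arccos_cos_lipschitz:
  assumes u: "0 \<le> u" "u < 2 * pi" and h: "0 \<le> h" "h \<le> pi"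
  shows "\<bar>arccos (cos (u + h)) - arccos (cos u)\<bar> \<le> h"
proof -
  have D: "arccos (cos v) = (if v \<le> pi then v else if v \<le> 2 * pi then 2 * pi - v else v - 2 * pi)"
    if "0 \<le> v" "v \<le> 3 * pi" for v
    using arccos_cos[of v] arccos_cos[of "2 * pi - v"] arccos_cos[of "v - 2 * pi"] that
      cos_periodic[of "v - 2 * pi"] by auto
  show ?thesis using D[of u] D[of "u + h"] u h by (auto split: if_splits)
qed

lemma abs_inner_circle_le_1:
  assumes "x \<in> circle" "y \<in> circle" shows "\<bar>x \<bullet> y\<bar> \<le> 1"
  using Cauchy_Schwarz_ineq2[of x y] assms by (simp add: circle_def)

lemma circle_dist_measurable:
  assumes "x \<in> circle" shows "circle_dist x \<in> borel_measurable circle_borel"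
proof -
  have "continuous_on circle (\<lambda>y. arccos (x \<bullet> y))"
  proof (intro continuous_intros ballI)
    fix y assume "y \<in> circle"
    then have "\<bar>x \<bullet> y\<bar> \<le> 1" by (rule abs_inner_circle_le_1[OF assms])
    then show "- 1 \<le> x \<bullet> y \<and> x \<bullet> y \<le> 1" by auto
  qed
  then show ?thesis
    unfolding circle_dist_def[abs_def] circle_borel_def by (rule borel_measurable_continuous_on_restrict)
qed

lemma circle_dist_bounded:
  assumes "x \<in> circle" "y \<in> circle" shows "\<bar>circle_dist x y\<bar> \<le> pi"
proof -
  have "\<bar>x \<bullet> y\<bar> \<le> 1" by (rule abs_inner_circle_le_1[OF assms])
  then have "0 \<le> arccos (x \<bullet> y)" "arccos (x \<bullet> y) \<le> pi" by (auto intro: arccos_lbound arccos_ubound)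
  then show ?thesis by (simp add: circle_dist_def)
qed

text \<open>
  The difference quotients of the distance are bounded by 1 and converge pointwise to \<open>1\<close> on the
  half circle behind \<open>e(t)\<close> and to \<open>- 1\<close> on the half circle ahead of it. Approaching from the right
  puts the point \<open>e(t)\<close> itself on the half circle behind and its antipode on the one ahead, so that
  both half circles are half-open arcs. The half circle ahead is written with angles in
  \<open>{t - 2 * pi<..t - pi}\<close>, so that the two together fill one window of angles.
\<close>

lemma circle_dist_integral_right_derivative:
  assumes \<mu>: "signed_measure circle_borel \<mu>"
  shows "(\<lambda>n. real (Suc n) *
      (signed_integral circle_borel \<mu> (circle_dist (circle_point (t + 1 / real (Suc n)))) -
       signed_integral circle_borel \<mu> (circle_dist (circle_point t))))
    \<longlonglongrightarrow> \<mu> (circle_arc (t - pi) t) - \<mu> (circle_arc (t - 2 * pi) (t - pi))"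
proof -
  define q where "q n y = real (Suc n) *
    (circle_dist (circle_point (t + 1 / real (Suc n))) y - circle_dist (circle_point t) y)" for n y
  \<comment> \<open>Measure angles backwards from \<open>t\<close>: then \<open>u < pi\<close> means that the point lies behind \<open>e(t)\<close>.\<close>
  have rep: "\<exists>u. 0 \<le> u \<and> u < 2 * pi \<and> y = circle_point (t - u)" if "y \<in> circle" for y
  proof -
    obtain s where "t - 2 * pi < s" "s \<le> t" "y = circle_point s"
      using circle_point_surj[OF \<open>y \<in> circle\<close>, of "t - 2 * pi"] by auto
    then show ?thesis by (intro exI[of _ "t - s"]) auto
  qed
  have q: "q n (circle_point (t - u)) =
      real (Suc n) * (arccos (cos (u + 1 / real (Suc n))) - arccos (cos u))" for n u
    by (simp add: q_def circle_dist_def inner_circle_point algebra_simps)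
  have "(\<lambda>n. signed_integral circle_borel \<mu> (q n)) \<longlonglongrightarrow> signed_integral circle_borel \<mu>
      (\<lambda>y. indicator (circle_arc (t - pi) t) y - indicator (circle_arc (t - 2 * pi) (t - pi)) y)"
  proof (rule signed_integral_bounded_convergence[OF \<mu>, where C = 1])
    show "q n \<in> borel_measurable circle_borel" for n
      unfolding q_def by (intro borel_measurable_times borel_measurable_diff borel_measurable_const
          circle_dist_measurable circle_point_in_circle)
  next
    fix n y assume "y \<in> space circle_borel"
    then obtain u where u: "0 \<le> u" "u < 2 * pi" "y = circle_point (t - u)"
      using rep by (auto simp: space_circle_borel)
    have "1 / real (Suc n) \<le> 1" by simp
    then have "1 / real (Suc n) \<le> pi" using pi_ge_two by linarith
    then have "\<bar>arccos (cos (u + 1 / real (Suc n))) - arccos (cos u)\<bar> \<le> 1 / real (Suc n)"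
      using u by (intro arccos_cos_lipschitz) auto
    then show "\<bar>q n y\<bar> \<le> 1"
      unfolding u(3) q abs_mult using mult_left_mono[of _ "1 / real (Suc n)" "real (Suc n)"]
      by simp
  next
    fix y assume "y \<in> space circle_borel"
    then obtain u where u: "0 \<le> u" "u < 2 * pi" "y = circle_point (t - u)"
      using rep by (auto simp: space_circle_borel)
    have "y \<in> circle_arc (t - pi) t \<longleftrightarrow> u < pi" "y \<in> circle_arc (t - 2 * pi) (t - pi) \<longleftrightarrow> \<not> u < pi"
      unfolding u(3) using u(1,2)
      by (subst circle_point_in_arc_iff[where c = "t - 2 * pi"]; auto)+
    then have "indicator (circle_arc (t - pi) t) y - indicator (circle_arc (t - 2 * pi) (t - pi)) y =
        (if u < pi then 1 else - 1 :: real)" by (simp add: indicator_def)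
    then show "(\<lambda>n. q n y) \<longlonglongrightarrow>
        indicator (circle_arc (t - pi) t) y - indicator (circle_arc (t - 2 * pi) (t - pi)) y"
      unfolding u(3) q using arccos_cos_diff_quotient[OF u(1,2)] by simp
  qed
  moreover have "signed_integral circle_borel \<mu> (q n) = real (Suc n) *
      (signed_integral circle_borel \<mu> (circle_dist (circle_point (t + 1 / real (Suc n)))) -
       signed_integral circle_borel \<mu> (circle_dist (circle_point t)))" for n
    unfolding q_def
    by (rule signed_integral_cmult_diff[OF \<mu>, where C = pi and D = pi])
      (auto simp: space_circle_borel intro: circle_dist_measurable circle_dist_bounded)
  ultimately show ?thesis
    by (simp add: signed_integral_indicator_diff[OF \<mu>] arc_in_sets)
qed

section \<open>From half circles to short arcs\<close>

text \<open>
  Passing from \<open>t = a\<close> to \<open>t = b\<close>, the half circle behind gains the arc \<open>A = (a, b]\<close> and loses its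
  antipode \<open>A'\<close>, while the half circle ahead gains \<open>A'\<close> and loses \<open>A\<close>. The two half circles have
  equal values at both times, hence \<open>\<mu> A - \<mu> A' = \<mu> A' - \<mu> A\<close>.
\<close>

lemma arc_antipodal_eq_if_half_circles_eq:
  assumes \<mu>: "signed_measure circle_borel \<mu>"
    and half: "\<And>t. \<mu> (circle_arc (t - pi) t) = \<mu> (circle_arc (t - 2 * pi) (t - pi))"
    and ab: "a \<le> b" "b \<le> a + pi"
  shows "\<mu> (circle_arc (a - pi) (b - pi)) = \<mu> (circle_arc a b)"
proof -
  have "\<mu> (circle_arc (b - pi) b) = \<mu> (circle_arc (b - pi) a) + \<mu> (circle_arc a b)"
    "\<mu> (circle_arc (b - 2 * pi) (b - pi)) = \<mu> (circle_arc (b - 2 * pi) (a - pi)) + \<mu> (circle_arc (a - pi) (b - pi))"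
    "\<mu> (circle_arc (a - pi) a) = \<mu> (circle_arc (a - pi) (b - pi)) + \<mu> (circle_arc (b - pi) a)"
    "\<mu> (circle_arc (a - 2 * pi) (a - pi)) =
      \<mu> (circle_arc (a - 2 * pi) (b - 2 * pi)) + \<mu> (circle_arc (b - 2 * pi) (a - pi))"
    using ab pi_gt_zero by (auto intro!: signed_measure_arc_add[OF \<mu>] simp del: pi_gt_zero)
  then show ?thesis
    using half[of a] half[of b] by (simp add: arc_shift)
qed

section \<open>Arcs determine a signed measure on the circle\<close>

definition circle_angle :: "real^2 \<Rightarrow> real" where
  "circle_angle = the_inv_into {- pi<..pi} circle_point"

lemma bij_circle_point: "bij_betw circle_point {- pi<..pi} circle"
proof -
  have "inj_on circle_point {- pi<..pi}"
    by (intro inj_onI circle_point_inj) auto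
  moreover have "circle_point ` {- pi<..pi} = circle"
    using arc_full[of "- pi"] by (simp add: circle_arc_def)
  ultimately show ?thesis by (simp add: bij_betw_def)
qed

lemma circle_point_angle: "y \<in> circle \<Longrightarrow> circle_point (circle_angle y) = y"
  unfolding circle_angle_def by (rule f_the_inv_into_f_bij_betw[OF bij_circle_point])

lemma circle_angle_range: assumes "y \<in> circle" shows "- pi < circle_angle y" "circle_angle y \<le> pi"
proof -
  have "circle_angle y \<in> {- pi<..pi}"
    unfolding circle_angle_def
    using bij_betw_apply[OF bij_betw_the_inv_into[OF bij_circle_point] assms] .
  then show "- pi < circle_angle y" "circle_angle y \<le> pi" by auto
qed

lemma circle_angle_vimage_atMost:
  "circle_angle -` {..b} \<inter> circle = (if b < pi then circle_arc (- pi) b else circle)"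
proof -
  have "y \<in> circle_arc (- pi) b \<longleftrightarrow> circle_angle y \<le> b" if "b < pi" "y \<in> circle" for y
    using circle_point_in_arc_iff[of "- pi" "circle_angle y" "- pi" b]
      circle_angle_range[of y] circle_point_angle[of y] that by auto
  then show ?thesis
    using arc_subset_circle[of "- pi" b] by (auto dest: circle_angle_range(2))
qed

lemma circle_angle_measurable: "circle_angle \<in> borel_measurable circle_borel"
proof -
  have "{y \<in> space circle_borel. circle_angle y \<le> b} \<in> sets circle_borel" for b
  proof -
    have "{y \<in> space circle_borel. circle_angle y \<le> b} = circle_angle -` {..b} \<inter> circle"
      by (auto simp: space_circle_borel)
    also have "\<dots> \<in> sets circle_borel"
      unfolding circle_angle_vimage_atMost
      using arc_in_sets[of b "- pi"] sets.top[of circle_borel] by (simp add: space_circle_borel)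
    finally show ?thesis .
  qed
  then show ?thesis by (simp add: borel_measurable_iff_le)
qed

text \<open>
  The push-forward of \<open>\<mu>\<close> under the angle function is a signed measure on the line. Its value on a
  ray is the value of \<open>\<mu>\<close> on the empty set, on an arc that starts at the angle \<open>- pi\<close>, or on the
  whole circle, so it vanishes. As the angle function is injective with Borel inverse, so does \<open>\<mu>\<close>.
\<close>

lemma signed_measure_circle_eq_0:
  assumes \<mu>: "signed_measure circle_borel \<mu>" and circle: "\<mu> circle = 0"
    and arc: "\<And>b. - pi < b \<Longrightarrow> b < pi \<Longrightarrow> \<mu> (circle_arc (- pi) b) = 0"
    and A: "A \<in> sets circle_borel"
  shows "\<mu> A = 0"
proof -
  let ?\<nu> = "signed_distr circle_borel circle_angle \<mu>"
  have "?\<nu> (circle_point -` A) = 0"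
  proof (rule signed_measure_borel_eq_0)
    show "signed_measure borel ?\<nu>" by (rule signed_measure_distr[OF \<mu> circle_angle_measurable])
    show "?\<nu> {..b} = 0" for b
    proof (cases "b \<le> - pi")
      case True
      then have "circle_arc (- pi) b = {}" by (simp add: circle_arc_def)
      moreover have "b < pi" using True pi_gt_zero by linarith
      ultimately show ?thesis
        using signed_measure_empty[OF \<mu>]
        by (simp add: signed_distr_def space_circle_borel circle_angle_vimage_atMost)
    qed (use arc[of b] circle in
        \<open>auto simp: signed_distr_def space_circle_borel circle_angle_vimage_atMost\<close>)
    show "?\<nu> UNIV = 0" using circle by (simp add: signed_distr_def space_circle_borel)
    have "circle_point \<in> borel_measurable borel"
      by (rule borel_measurable_continuous_onI[OF continuous_circle_point])
    then show "circle_point -` A \<in> sets borel"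
      using A by (auto simp: sets_circle_borel dest: measurable_sets)
  qed
  moreover have "circle_angle -` circle_point -` A \<inter> circle = A"
    using A by (auto simp: sets_circle_borel circle_point_angle)
  ultimately show ?thesis by (simp add: signed_distr_def space_circle_borel)
qed

section \<open>Uniqueness of the anti-symmetric part\<close>

theorem lemma1p3:
  fixes f :: "real^2 \<Rightarrow> real"
    and lam eta :: "(real^2) set \<Rightarrow> real"
  assumes "signed_measure circle_borel lam"
    and "signed_measure circle_borel eta"
    and "\<And>x. x \<in> circle \<Longrightarrow> f x = signed_integral circle_borel lam (\<lambda>y. circle_dist x y)"
    and "\<And>x. x \<in> circle \<Longrightarrow> f x = signed_integral circle_borel eta (\<lambda>y. circle_dist x y)"
  shows "\<forall>A \<in> sets circle_borel. antisym_part lam A = antisym_part eta A"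
proof
  fix A assume A: "A \<in> sets circle_borel"
  define \<mu> where "\<mu> A = lam A - eta A" for A
  define \<delta> where "\<delta> A = \<mu> A - signed_distr circle_borel antipodal \<mu> A" for A
  have \<mu>: "signed_measure circle_borel \<mu>"
    unfolding \<mu>_def by (rule signed_measure_diff[OF assms(1,2)])
  have \<delta>: "signed_measure circle_borel \<delta>"
    unfolding \<delta>_def by (intro signed_measure_diff \<mu> signed_measure_distr measurable_antipodal)
  have int_eq: "signed_integral circle_borel eta (circle_dist (circle_point t)) =
      signed_integral circle_borel lam (circle_dist (circle_point t))" for t
    using assms(3,4)[of "circle_point t"] by simp
  have half: "\<mu> (circle_arc (t - pi) t) = \<mu> (circle_arc (t - 2 * pi) (t - pi))" for t
    using LIMSEQ_unique[OF circle_dist_integral_right_derivative[OF assms(1), of t]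
        circle_dist_integral_right_derivative[OF assms(2), of t, unfolded int_eq]]
    by (simp add: \<mu>_def)
  have short: "\<delta> (circle_arc a b) = 0" if "a \<le> b" "b \<le> a + pi" for a b
    using arc_antipodal_eq_if_half_circles_eq[OF \<mu> half that]
    by (simp add: \<delta>_def signed_distr_def space_circle_borel antipodal_vimage_arc)
  have "\<delta> A = 0"
  proof (rule signed_measure_circle_eq_0[OF \<delta> _ _ A])
    have "antipodal -` circle \<inter> circle = circle"
      by (auto simp: antipodal_def circle_def)
    then show "\<delta> circle = 0"
      by (simp add: \<delta>_def signed_distr_def space_circle_borel)
    show "\<delta> (circle_arc (- pi) b) = 0" if b: "- pi < b" "b < pi" for b
    \<comment> \<open>An arc longer than a half circle is cut into two short ones.\<close>
    proof (cases "b \<le> 0")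
      case True
      then show ?thesis using b by (intro short) auto
    next
      case False
      then have "\<delta> (circle_arc (- pi) b) = \<delta> (circle_arc (- pi) 0) + \<delta> (circle_arc 0 b)"
        using b by (intro signed_measure_arc_add[OF \<delta>]) auto
      then show ?thesis using False b by (simp add: short)
    qed
  qed
  then show "antisym_part lam A = antisym_part eta A"
    by (simp add: \<delta>_def \<mu>_def antisym_part_def signed_distr_def)
qed

end
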